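(* Let $A=\{a^1,\dots,a^m\}\subset\mathbb R^n$ be a data set, let $k$ be a positive integer with $k\le m$, let $\ell$ be an index with $1\le\ell\le k-1$, and let $\bar x=(\bar x^1,\dots,\bar x^\ell)\in\mathbb R^{n\times\ell}$ be an approximate solution of the problem $$\min\Big\{f_\ell(x):=\frac1m\sum_{i=1}^m\Big(\min_{j=1,\dots,\ell}\|a^i-x^j\|^2\Big)\ \Big|\ x=(x^1,\dots,x^\ell)\in\mathbb R^{n\times\ell}\Big\}.$$ If the data points $a^1,\dots,a^m$ are pairwise distinct and the centroids $\bar x^1,\dots,\bar x^\ell$ are pairwise distinct, then for the approximate solution $\hat x=(\hat x^1,\dots,\hat x^{\ell+1})$ of the problem $$\min\Big\{f_{\ell+1}(x):=\frac1m\sum_{i=1}^m\Big(\min_{j=1,\dots,\ell+1}\|a^i-x^j\|^2\Big)\ \Big|\ x=(x^1,\dots,x^{\ell+1})\in\mathbb R^{n\times(\ell+1)}\Big\}$$ obtained from $\bar x$ by Procedure 2 (described in the context), the centroids $\hat x^1,\dots,\hat x^{\ell+1}$ are also pairwise distinct.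
   Context: $\mathbb R^n$ carries the Euclidean norm $\|\cdot\|$; $I=\{1,\dots,m\}$; $|\Omega|$ is the number of elements of a finite set $\Omega$. A vector $x=(x^1,\dots,x^r)\in\mathbb R^{n\times r}$ with $x^j\in\mathbb R^n$ is called a centroid system. The phrase "approximate solution" imposes no quantitative accuracy requirement: it just designates a centroid system with the given number of centroids. **The $k$-means algorithm (KM) with $r$ centroids**, with a tolerance $\varepsilon\ge0$, started at an initial centroid system $(x^1,\dots,x^r)$: repeat the following. (i) Form the natural clustering: $A^0=\emptyset$ and, inductively for $j=1,\dots,r$, $$A^j=\Big\{a^i\in A\setminus\bigcup_{p=0}^{j-1}A^p\ \Big|\ \|a^i-x^j\|=\min_{q=1,\dots,r}\|a^i-x^q\|\Big\}.$$ (ii) For each $j$ with $A^j\ne\emptyset$ put $\widetilde x^j=\frac1{|I(A^j)|}\sum_{i\in I(A^j)}a^i$, where $I(A^j)=\{i\in I\mid a^i\in A^j\}$; for each $j$ with $A^j=\emptyset$ put $\widetilde x^j=x^j$. Replace $x^j$ by $\widetilde x^j$ for all $j$. (iii) If in this iteration $\|\widetilde x^j-x^j\|\le\varepsilon$ for all $j$ with $A^j\neq\emptyset$, stop and output the current centroid system; otherwise go to (i). **Procedure 2.** Input: a centroid system $\bar x=(\bar x^1,\dots,\bar x^\ell)$. Define $d_\ell(a^i)=\min\{\|\bar x^1-a^i\|^2,\dots,\|\bar x^\ell-a^i\|^2\}$ for $i\in I$, $$Y_1=\{y\in\mathbb R^n\mid\exists i\in I\text{ with }\|y-a^i\|^2<d_\ell(a^i)\},$$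 $A_1(y)=\{a^i\in A\mid\|y-a^i\|^2<d_\ell(a^i)\}$ for $y\in Y_1$, and $$z_{\ell+1}(y)=\frac1m\sum_{i\in I}\max\{0,\,d_\ell(a^i)-\|y-a^i\|^2\}\qquad(y\in\mathbb R^n).$$ Step 1. Select control parameters $\gamma_1\in[0,1]$, $\gamma_2\in[0,1]$, $\gamma_3\in[1,\infty)$. Step 2. Compute $z^1_{\max}=\max\{z_{\ell+1}(a)\mid a\in A\cap Y_1\}$ and $\bar A_1=\{a\in A\cap Y_1\mid z_{\ell+1}(a)\ge\gamma_1z^1_{\max}\}$. Step 3. For each $a\in\bar A_1$ let $c(a)$ be the barycenter (arithmetic mean) of the set $A_1(a)$. Put $\bar A_2=\{c(a)\mid a\in\bar A_1\}$, $z^2_{\max}=\max\{z_{\ell+1}(c)\mid c\in\bar A_2\}$, and $\bar A_3=\{c\in\bar A_2\mid z_{\ell+1}(c)\ge\gamma_2z^2_{\max}\}$. Step 4. Form $\Omega=\{(\bar x^1,\dots,\bar x^\ell,c)\mid c\in\bar A_3\}$. Step 5. Apply KM with $\ell+1$ centroids from each initial centroid system $(\bar x^1,\dots,\bar x^\ell,c)\in\Omega$; let $\widetilde A_4\subset\mathbb R^{n\times(\ell+1)}$ be the set of the resulting centroid systems. Step 6. Compute $\widetilde f^{\min}_{\ell+1}=\min\{f_{\ell+1}(x)\mid x\in\widetilde A_4\}$ and $\widetilde A_5=\{x\in\widetilde A_4\mid f_{\ell+1}(x)\le\gamma_3\widetilde f^{\min}_{\ell+1}\}$. Step 7. Output an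 (arbitrarily picked) point $\hat x=(\hat x^1,\dots,\hat x^{\ell+1})\in\widetilde A_5$. *)

theory Defs
  imports "HOL-Analysis.Analysis"
begin

(* Data points and centroids are indexed from 1.  A system of r centroids is a function
   x :: nat => real^'n of which only the values x 1, ..., x r are relevant. *)

definition data_set :: "(nat \<Rightarrow> real^'n) \<Rightarrow> nat \<Rightarrow> (real^'n) set" where
  "data_set a m = a ` {1..m}"

definition clustering_obj :: "(nat \<Rightarrow> real^'n) \<Rightarrow> nat \<Rightarrow> nat \<Rightarrow> (nat \<Rightarrow> real^'n) \<Rightarrow> real" where
  "clustering_obj a m r x =
     (1 / real m) * (\<Sum>i=1..m. Min ((\<lambda>j. (norm (a i - x j))\<^sup>2) ` {1..r}))"


fun natural_cluster ::
  "(nat \<Rightarrow> real^'n) \<Rightarrow> nat \<Rightarrow> nat \<Rightarrow> (nat \<Rightarrow> real^'n) \<Rightarrow> nat \<Rightarrow> (real^'n) set" where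
  "natural_cluster a m r x 0 = {}"
| "natural_cluster a m r x (Suc j) =
     {b \<in> data_set a m - (\<Union>p\<in>{0..j}. natural_cluster a m r x p).
        norm (b - x (Suc j)) = Min ((\<lambda>q. norm (b - x q)) ` {1..r})}"

definition cluster_indices ::
  "(nat \<Rightarrow> real^'n) \<Rightarrow> nat \<Rightarrow> nat \<Rightarrow> (nat \<Rightarrow> real^'n) \<Rightarrow> nat \<Rightarrow> nat set" where
  "cluster_indices a m r x j = {i \<in> {1..m}. a i \<in> natural_cluster a m r x j}"

definition km_update ::
  "(nat \<Rightarrow> real^'n) \<Rightarrow> nat \<Rightarrow> nat \<Rightarrow> (nat \<Rightarrow> real^'n) \<Rightarrow> nat \<Rightarrow> real^'n" where
  "km_update a m r x j =
     (if j \<in> {1..r} \<and> natural_cluster a m r x j \<noteq> {}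
      then (1 / real (card (cluster_indices a m r x j))) *\<^sub>R (\<Sum>i\<in>cluster_indices a m r x j. a i)
      else x j)"

definition km_stop ::
  "(nat \<Rightarrow> real^'n) \<Rightarrow> nat \<Rightarrow> real \<Rightarrow> nat \<Rightarrow> (nat \<Rightarrow> real^'n) \<Rightarrow> bool" where
  "km_stop a m \<epsilon> r x \<longleftrightarrow>
     (\<forall>j\<in>{1..r}. natural_cluster a m r x j \<noteq> {} \<longrightarrow> norm (km_update a m r x j - x j) \<le> \<epsilon>)"

(* km_output a m \<epsilon> r x y: the k-means algorithm with r centroids and tolerance \<epsilon>, started at x,
   stops and outputs y, which is the system after the update of the last iteration. *)
inductive km_output ::
  "(nat \<Rightarrow> real^'n) \<Rightarrow> nat \<Rightarrow> real \<Rightarrow> nat \<Rightarrow> (nat \<Rightarrow> real^'n) \<Rightarrow> (nat \<Rightarrow> real^'n) \<Rightarrow> bool"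
  for a :: "nat \<Rightarrow> real^'n" and m :: nat and \<epsilon> :: real and r :: nat where
  stop: "km_stop a m \<epsilon> r x \<Longrightarrow> km_output a m \<epsilon> r x (km_update a m r x)"
| iterate: "\<not> km_stop a m \<epsilon> r x \<Longrightarrow> km_output a m \<epsilon> r (km_update a m r x) y
     \<Longrightarrow> km_output a m \<epsilon> r x y"


definition dist_sq :: "nat \<Rightarrow> (nat \<Rightarrow> real^'n) \<Rightarrow> real^'n \<Rightarrow> real" where
  "dist_sq l xbar b = Min ((\<lambda>j. (norm (xbar j - b))\<^sup>2) ` {1..l})"

definition Y1 :: "(nat \<Rightarrow> real^'n) \<Rightarrow> nat \<Rightarrow> nat \<Rightarrow> (nat \<Rightarrow> real^'n) \<Rightarrow> (real^'n) set" where
  "Y1 a m l xbar = {y. \<exists>i\<in>{1..m}. (norm (y - a i))\<^sup>2 < dist_sq l xbar (a i)}"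

definition A1 ::
  "(nat \<Rightarrow> real^'n) \<Rightarrow> nat \<Rightarrow> nat \<Rightarrow> (nat \<Rightarrow> real^'n) \<Rightarrow> real^'n \<Rightarrow> (real^'n) set" where
  "A1 a m l xbar y = {b \<in> data_set a m. (norm (y - b))\<^sup>2 < dist_sq l xbar b}"

definition z_next ::
  "(nat \<Rightarrow> real^'n) \<Rightarrow> nat \<Rightarrow> nat \<Rightarrow> (nat \<Rightarrow> real^'n) \<Rightarrow> real^'n \<Rightarrow> real" where
  "z_next a m l xbar y =
     (1 / real m) * (\<Sum>i=1..m. max 0 (dist_sq l xbar (a i) - (norm (y - a i))\<^sup>2))"

definition barycenter :: "(real^'n) set \<Rightarrow> real^'n" where
  "barycenter S = (1 / real (card S)) *\<^sub>R (\<Sum>b\<in>S. b)"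

definition zmax1 :: "(nat \<Rightarrow> real^'n) \<Rightarrow> nat \<Rightarrow> nat \<Rightarrow> (nat \<Rightarrow> real^'n) \<Rightarrow> real" where
  "zmax1 a m l xbar = Max (z_next a m l xbar ` (data_set a m \<inter> Y1 a m l xbar))"

definition Abar1 ::
  "(nat \<Rightarrow> real^'n) \<Rightarrow> nat \<Rightarrow> nat \<Rightarrow> (nat \<Rightarrow> real^'n) \<Rightarrow> real \<Rightarrow> (real^'n) set" where
  "Abar1 a m l xbar \<gamma>1 =
     {b \<in> data_set a m \<inter> Y1 a m l xbar. z_next a m l xbar b \<ge> \<gamma>1 * zmax1 a m l xbar}"

definition Abar2 ::
  "(nat \<Rightarrow> real^'n) \<Rightarrow> nat \<Rightarrow> nat \<Rightarrow> (nat \<Rightarrow> real^'n) \<Rightarrow> real \<Rightarrow> (real^'n) set" where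
  "Abar2 a m l xbar \<gamma>1 = (\<lambda>b. barycenter (A1 a m l xbar b)) ` Abar1 a m l xbar \<gamma>1"

definition zmax2 :: "(nat \<Rightarrow> real^'n) \<Rightarrow> nat \<Rightarrow> nat \<Rightarrow> (nat \<Rightarrow> real^'n) \<Rightarrow> real \<Rightarrow> real" where
  "zmax2 a m l xbar \<gamma>1 = Max (z_next a m l xbar ` Abar2 a m l xbar \<gamma>1)"

definition Abar3 ::
  "(nat \<Rightarrow> real^'n) \<Rightarrow> nat \<Rightarrow> nat \<Rightarrow> (nat \<Rightarrow> real^'n) \<Rightarrow> real \<Rightarrow> real \<Rightarrow> (real^'n) set" where
  "Abar3 a m l xbar \<gamma>1 \<gamma>2 =
     {c \<in> Abar2 a m l xbar \<gamma>1. z_next a m l xbar c \<ge> \<gamma>2 * zmax2 a m l xbar \<gamma>1}"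

definition Omega ::
  "(nat \<Rightarrow> real^'n) \<Rightarrow> nat \<Rightarrow> nat \<Rightarrow> (nat \<Rightarrow> real^'n) \<Rightarrow> real \<Rightarrow> real \<Rightarrow> (nat \<Rightarrow> real^'n) set" where
  "Omega a m l xbar \<gamma>1 \<gamma>2 = (\<lambda>c. xbar(l + 1 := c)) ` Abar3 a m l xbar \<gamma>1 \<gamma>2"

definition Atilde4 ::
  "(nat \<Rightarrow> real^'n) \<Rightarrow> nat \<Rightarrow> real \<Rightarrow> nat \<Rightarrow> (nat \<Rightarrow> real^'n) \<Rightarrow> real \<Rightarrow> real
     \<Rightarrow> (nat \<Rightarrow> real^'n) set" where
  "Atilde4 a m \<epsilon> l xbar \<gamma>1 \<gamma>2 =
     {y. \<exists>x\<in>Omega a m l xbar \<gamma>1 \<gamma>2. km_output a m \<epsilon> (l + 1) x y}"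

definition fmin ::
  "(nat \<Rightarrow> real^'n) \<Rightarrow> nat \<Rightarrow> real \<Rightarrow> nat \<Rightarrow> (nat \<Rightarrow> real^'n) \<Rightarrow> real \<Rightarrow> real \<Rightarrow> real" where
  "fmin a m \<epsilon> l xbar \<gamma>1 \<gamma>2 =
     Min (clustering_obj a m (l + 1) ` Atilde4 a m \<epsilon> l xbar \<gamma>1 \<gamma>2)"

definition Atilde5 ::
  "(nat \<Rightarrow> real^'n) \<Rightarrow> nat \<Rightarrow> real \<Rightarrow> nat \<Rightarrow> (nat \<Rightarrow> real^'n) \<Rightarrow> real \<Rightarrow> real \<Rightarrow> real
     \<Rightarrow> (nat \<Rightarrow> real^'n) set" where
  "Atilde5 a m \<epsilon> l xbar \<gamma>1 \<gamma>2 \<gamma>3 =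
     {x \<in> Atilde4 a m \<epsilon> l xbar \<gamma>1 \<gamma>2.
        clustering_obj a m (l + 1) x \<le> \<gamma>3 * fmin a m \<epsilon> l xbar \<gamma>1 \<gamma>2}"

(* The selection of the control parameters and of the output point is nondeterministic,
   hence a relation between the input xbar and the possible outputs xhat. *)
definition procedure2 ::
  "(nat \<Rightarrow> real^'n) \<Rightarrow> nat \<Rightarrow> real \<Rightarrow> nat \<Rightarrow> (nat \<Rightarrow> real^'n) \<Rightarrow> (nat \<Rightarrow> real^'n) \<Rightarrow> bool" where
  "procedure2 a m \<epsilon> l xbar xhat \<longleftrightarrow>
     (\<exists>\<gamma>1\<in>{0..1}. \<exists>\<gamma>2\<in>{0..1}. \<exists>\<gamma>3\<in>{1..}. xhat \<in> Atilde5 a m \<epsilon> l xbar \<gamma>1 \<gamma>2 \<gamma>3)"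

end

(* Every update of a centroid is a mean of points of a convex half-space. Of two clusters i < j,
   the points of cluster i are at least as close to x^i as to x^j, and ties go to the smaller index,
   so the points of cluster j are strictly closer to x^j. The two half-spaces bounded by the
   bisector of x^i and x^j are disjoint, and a centroid of an empty cluster lies in its own one,
   hence each iteration of k-means keeps the centroids distinct. The starting centroid c is a mean
   of data points that are strictly closer to some data point b than to any of the given
   centroids, so it differs from all of them. *)
theory Submission
  imports Defs
begin

text \<open>After squaring both norms the term \<open>inner b b\<close> cancels, so the condition is
  linear in \<open>b\<close>: a half-space bounded by the bisector of \<open>u\<close> and
  \<open>v\<close> when these differ.\<close>

lemma convex_closer_le: "convex {b :: 'a::real_inner. norm (b - u) \<le> norm (b - v)}"
proof -
  have "norm (b - u) \<le> norm (b - v) \<longleftrightarrow> inner (v - u) b \<le> (inner v v - inner u u) / 2" for b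
    unfolding norm_le inner_diff_left inner_diff_right
    using inner_commute[of u b] inner_commute[of v b] by auto
  then show ?thesis by (simp only: convex_halfspace_le)
qed

lemma convex_closer_lt: "convex {b :: 'a::real_inner. norm (b - u) < norm (b - v)}"
proof -
  have "norm (b - u) < norm (b - v) \<longleftrightarrow> inner (v - u) b < (inner v v - inner u u) / 2" for b
    unfolding norm_lt inner_diff_left inner_diff_right
    using inner_commute[of u b] inner_commute[of v b] by auto
  then show ?thesis by (simp only: convex_halfspace_lt)
qed

lemma mean_in_convex:
  fixes f :: "'b \<Rightarrow> 'a::real_vector"
  assumes "convex C" "finite S" "S \<noteq> {}" "\<And>i. i \<in> S \<Longrightarrow> f i \<in> C"
  shows "(1 / real (card S)) *\<^sub>R (\<Sum>i\<in>S. f i) \<in> C"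
proof -
  have "(\<Sum>i\<in>S. (1 / real (card S)) *\<^sub>R f i) \<in> C"
    by (rule convex_sum[OF assms(2,1)]) (use assms in auto)
  then show ?thesis by (simp add: scaleR_sum_right)
qed

lemma natural_cluster_subset: "natural_cluster a m r x j \<subseteq> data_set a m"
  by (cases j) auto

lemma natural_cluster_closer_le:
  assumes "b \<in> natural_cluster a m r x j" "q \<in> {1..r}"
  shows "norm (b - x j) \<le> norm (b - x q)"
proof (cases j)
  case (Suc j')
  then have "norm (b - x j) = Min ((\<lambda>q. norm (b - x q)) ` {1..r})"
    using assms(1) by simp
  then show ?thesis using assms(2) by simp
qed (use assms in simp)

lemma natural_cluster_closer_lt:
  assumes b: "b \<in> natural_cluster a m r x j" and "1 \<le> i" "i < j" "j \<le> r"
  shows "norm (b - x j) < norm (b - x i)"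
proof (rule ccontr)
  assume "\<not> norm (b - x j) < norm (b - x i)"
  moreover have "norm (b - x j) \<le> norm (b - x i)"
    using natural_cluster_closer_le[OF b] assms by simp
  ultimately have eq: "norm (b - x i) = norm (b - x j)" by simp
  obtain i' j' where ij: "i = Suc i'" "j = Suc j'"
    using assms by (cases i; cases j) auto
  have b': "b \<in> data_set a m" "b \<notin> natural_cluster a m r x p" if "p \<le> j'" for p
    using b that unfolding ij by auto
  have "norm (b - x i) = Min ((\<lambda>q. norm (b - x q)) ` {1..r})"
    using b eq unfolding ij by simp
  \<comment> \<open>In a tie \<open>x i\<close> attains the minimum too, and \<open>b\<close> lies
    in no cluster of index below \<open>i\<close>, so the recursion would already have placed it in
    cluster \<open>i\<close>.\<close>
  then have "b \<in> natural_cluster a m r x i"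
    using b' assms unfolding ij by auto
  then show False using b'(2)[of i] assms ij by simp
qed

text \<open>The assumption on \<open>x j\<close> handles an empty cluster, where the update leaves
  the centroid in place.\<close>

lemma km_update_in_convex:
  assumes "convex C" "x j \<in> C" "natural_cluster a m r x j \<subseteq> C"
  shows "km_update a m r x j \<in> C"
proof (cases "j \<in> {1..r} \<and> natural_cluster a m r x j \<noteq> {}")
  case True
  then obtain b where b: "b \<in> natural_cluster a m r x j" by blast
  then have "b \<in> a ` {1..m}"
    using natural_cluster_subset unfolding data_set_def by blast
  \<comment> \<open>The mean runs over indices, so it is the index set that must be nonempty to
    avoid the default value of division by zero.\<close>
  then have "cluster_indices a m r x j \<noteq> {}"
    using b unfolding cluster_indices_def by blast
  moreover have "finite (cluster_indices a m r x j)"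
    by (simp add: cluster_indices_def)
  ultimately show ?thesis
    using True assms mean_in_convex[of C "cluster_indices a m r x j" a]
    by (auto simp: km_update_def cluster_indices_def)
next
  case False
  then show ?thesis using assms(2) unfolding km_update_def by presburger
qed

lemma inj_on_km_update:
  assumes inj: "inj_on x {1..r}"
  shows "inj_on (km_update a m r x) {1..r}"
\<comment> \<open>Ordering the indices matches the tie rule: weak inequality for the smaller index,
  strict for the larger.\<close>
proof (rule linorder_inj_onI)
  fix i j assume ij: "i < j" "i \<in> {1..r}" "j \<in> {1..r}"
  have neq: "x i \<noteq> x j"
    using inj_onD[OF inj, of i j] ij by auto
  have "km_update a m r x i \<in> {b. norm (b - x i) \<le> norm (b - x j)}"
    using natural_cluster_closer_le[of _ a m r x i j] ij
    by (intro km_update_in_convex convex_closer_le) auto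
  \<comment> \<open>Here \<open>neq\<close> puts \<open>x j\<close> itself into the open
    half-space.\<close>
  moreover have "km_update a m r x j \<in> {b. norm (b - x j) < norm (b - x i)}"
    using natural_cluster_closer_lt[of _ a m r x j i] ij neq
    by (intro km_update_in_convex convex_closer_lt) auto
  ultimately show "km_update a m r x i \<noteq> km_update a m r x j" by auto
qed auto

text \<open>Induction over a terminating run; the \<open>stop\<close> case still performs one
  update.\<close>

lemma inj_on_km_output:
  assumes "km_output a m \<epsilon> r x y" "inj_on x {1..r}"
  shows "inj_on y {1..r}"
  using assms by induction (blast intro: inj_on_km_update)+

lemma barycenter_A1_neq:
  assumes "b \<in> Y1 a m l xbar" "j \<in> {1..l}"
  shows "barycenter (A1 a m l xbar b) \<noteq> xbar j"
proof -
  \<comment> \<open>This convex set misses \<open>xbar j\<close>, since membership would give a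
    negative norm.\<close>
  let ?C = "{p. norm (p - b) < norm (p - xbar j)}"
  have "p \<in> ?C" if "p \<in> A1 a m l xbar b" for p
  proof -
    have "dist_sq l xbar p \<le> (norm (xbar j - p))\<^sup>2"
      using assms(2) by (auto simp: dist_sq_def)
    then have "(norm (b - p))\<^sup>2 < (norm (xbar j - p))\<^sup>2"
      using that by (auto simp: A1_def)
    then show ?thesis
      using power_less_imp_less_base[of "norm (b - p)" 2 "norm (xbar j - p)"]
      by (simp add: norm_minus_commute[of p])
  qed
  \<comment> \<open>The index witnessing \<open>b\<close> in \<open>Y1\<close> supplies an
    element.\<close>
  moreover have "A1 a m l xbar b \<noteq> {}"
    using assms(1) by (auto simp: Y1_def A1_def data_set_def)
  moreover have "finite (A1 a m l xbar b)"
    by (simp add: A1_def data_set_def)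
  ultimately have "barycenter (A1 a m l xbar b) \<in> ?C"
    unfolding barycenter_def by (intro mean_in_convex convex_closer_lt) auto
  then show ?thesis by auto
qed

lemma inj_on_Omega:
  assumes "inj_on xbar {1..l}" "x \<in> Omega a m l xbar \<gamma>1 \<gamma>2"
  shows "inj_on x {1..l + 1}"
proof -
  obtain b where b: "b \<in> Y1 a m l xbar"
    and x: "x = xbar(l + 1 := barycenter (A1 a m l xbar b))"
    using assms(2) by (auto simp: Omega_def Abar3_def Abar2_def Abar1_def)
  have "barycenter (A1 a m l xbar b) \<notin> xbar ` {1..l}"
    using barycenter_A1_neq[OF b] by blast
  then show ?thesis
    unfolding x using assms(1) by (simp add: atLeastAtMostSuc_conv inj_on_fun_updI)
qed

theorem theorem3p6:
  fixes a :: "nat \<Rightarrow> real^'n" and m k l :: nat and \<epsilon> :: real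
    and xbar xhat :: "nat \<Rightarrow> real^'n"
  assumes "1 \<le> k" and "k \<le> m"
    and "1 \<le> l" and "l \<le> k - 1"
    and "0 \<le> \<epsilon>"
    and "inj_on a {1..m}"
    and "inj_on xbar {1..l}"
    and "procedure2 a m \<epsilon> l xbar xhat"
  shows "inj_on xhat {1..l + 1}"
proof -
  obtain \<gamma>1 \<gamma>2 x where "x \<in> Omega a m l xbar \<gamma>1 \<gamma>2" "km_output a m \<epsilon> (l + 1) x xhat"
    using assms(8) by (auto simp: procedure2_def Atilde5_def Atilde4_def)
  then show ?thesis
    using inj_on_km_output inj_on_Omega[OF assms(7)] by blast
qed

end
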